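(* There does not exist an optimal $(3k(k-1)+2,k,1)$-optical orthogonal code if $k = (4^{a+1}(24c+7)+2)/3$ for some integers $a ,c \geq 0$, or if $k = 4^{a+1}(8c+5)$ for some integers $a , c \geq 0$.
   Context: A $(v,k,1)$-optical orthogonal code ($(v,k,1)$-OOC) of size $n$ is a set $\mathcal{C}$ of $n$ $(0,1)$-vectors of length $v$, each of Hamming weight $k$, such that (with subscripts reduced modulo $v$): for every $\mathbf{x}=(x_0,\dots,x_{v-1}) \in \mathcal{C}$ and every integer $0<\tau<v$, $\sum_{i=0}^{v-1} x_i x_{i+\tau} \le 1$; and for all $\mathbf{x}\ne\mathbf{y}$ in $\mathcal{C}$ and every integer $0\le\tau<v$, $\sum_{i=0}^{v-1} x_i y_{i+\tau} \le 1$. The size of a $(v,k,1)$-OOC is always at most $\left\lfloor \frac{v-1}{k(k-1)} \right\rfloor$; it is called optimal if its size equals $\left\lfloor \frac{v-1}{k(k-1)} \right\rfloor$. *)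

theory Defs
  imports Complex_Main
begin

definition hamming_weight :: "nat list \<Rightarrow> nat" where
  "hamming_weight x = card {i. i < length x \<and> x ! i \<noteq> 0}"

definition is_OOC :: "nat \<Rightarrow> nat \<Rightarrow> nat list set \<Rightarrow> bool" where
  "is_OOC v k C \<longleftrightarrow>
     (\<forall>x\<in>C. length x = v \<and> set x \<subseteq> {0, 1} \<and> hamming_weight x = k) \<and>
     (\<forall>x\<in>C. \<forall>\<tau>. 0 < \<tau> \<and> \<tau> < v \<longrightarrow> (\<Sum>i<v. x ! i * x ! ((i + \<tau>) mod v)) \<le> 1) \<and>
     (\<forall>x\<in>C. \<forall>y\<in>C. x \<noteq> y \<longrightarrow>
        (\<forall>\<tau>. \<tau> < v \<longrightarrow> (\<Sum>i<v. x ! i * y ! ((i + \<tau>) mod v)) \<le> 1))"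

text \<open>Division on naturals is the floor of the quotient.  Only finitely many
  0-1 vectors have length \<open>v\<close>, so \<open>card C\<close> is the true size of the code.\<close>

definition is_optimal_OOC :: "nat \<Rightarrow> nat \<Rightarrow> nat list set \<Rightarrow> bool" where
  "is_optimal_OOC v k C \<longleftrightarrow> is_OOC v k C \<and> card C = (v - 1) div (k * (k - 1))"

end

theory Submission
  imports Defs
begin

text \<open>
  Put \<open>v = 3k(k - 1) + 2\<close>.  An optimal code has three codewords; let \<open>S\<^sub>1, S\<^sub>2, S\<^sub>3\<close> be
  their supports, \<open>k\<close>-subsets of \<open>\<int>/v\<close>.  The correlation conditions say that the
  \<open>3k(k - 1)\<close> differences of distinct elements within the supports are pairwise
  distinct (\<open>inj_on_difference\<close>).  The element \<open>v/2\<close> is its own negative, so it would occur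
  twice if it occurred at all; hence the differences are exactly the elements of \<open>\<int>/v\<close>
  other than \<open>0\<close> and \<open>v/2\<close> (\<open>image_difference\<close>).

  Now sum the character \<open>d \<mapsto> (-1)\<^sup>d\<close> of \<open>\<int>/v\<close> over all differences in two ways.
  If \<open>s\<^sub>j\<close> is the sum of \<open>(-1)\<^sup>a\<close> over \<open>a \<in> S\<^sub>j\<close>, this gives
  \<open>s\<^sub>1\<^sup>2 + s\<^sub>2\<^sup>2 + s\<^sub>3\<^sup>2 = 3k - 1 - (-1)\<^bsup>v/2\<^esup>\<close> (\<open>sum_character_squares\<close>).
  For \<open>k = (4\<^bsup>a+1\<^esup>(24c + 7) + 2)/3\<close> the half-length \<open>v/2\<close> is even and the right-hand side is
  \<open>3k - 2 = 4\<^bsup>a+1\<^esup>(8 \<cdot> 3c + 7)\<close>; for \<open>k = 4\<^bsup>a+1\<^esup>(8c + 5)\<close> it is odd and the right-hand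
  side is \<open>3k = 4\<^bsup>a+1\<^esup>(8(3c + 1) + 7)\<close>.  Neither is a sum of three squares
  (\<open>not_sum_three_squares\<close>).
\<close>

section \<open>Integers that are not sums of three squares\<close>

lemma mod_add3_eq: "(x mod m + y mod m + z mod m) mod m = (x + y + z) mod m" for x y z m :: int
  by (intro mod_add_cong mod_mod_trivial)

lemma even_if_sum_three_squares_mod_4:
  fixes x y z :: int
  assumes "4 dvd x\<^sup>2 + y\<^sup>2 + z\<^sup>2"
  shows "even x \<and> even y \<and> even z"
proof -
  have sq: "w\<^sup>2 mod 4 = (if even w then 0 else 1)" for w :: int
  proof (cases "even w")
    case True
    then obtain u where "w = 2 * u" by (elim evenE)
    then show ?thesis by (simp add: power2_eq_square)
  next
    case False
    then obtain u where "w = 2 * u + 1" by (elim oddE)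
    then have "w\<^sup>2 = 1 + 4 * (u\<^sup>2 + u)" by (simp add: power2_eq_square algebra_simps)
    then have "w\<^sup>2 mod 4 = 1" by presburger
    with False show ?thesis by simp
  qed
  have "(x\<^sup>2 mod 4 + y\<^sup>2 mod 4 + z\<^sup>2 mod 4) mod 4 = 0"
    using assms unfolding mod_add3_eq by simp
  then show ?thesis unfolding sq by (auto split: if_splits)
qed

lemma not_sum_three_squares:
  fixes x y z :: int
  shows "x\<^sup>2 + y\<^sup>2 + z\<^sup>2 \<noteq> 4 ^ a * (8 * b + 7)"
proof (induction a arbitrary: x y z)
  case 0
  have sq: "w\<^sup>2 mod 8 \<in> {0, 1, 4}" for w :: int
  proof -
    have "w mod 8 \<in> {0, 1, 2, 3, 4, 5, 6, 7}" by auto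
    moreover have "w\<^sup>2 mod 8 = (w mod 8)\<^sup>2 mod 8" by (simp add: power_mod)
    ultimately show ?thesis by auto
  qed
  have "(x\<^sup>2 mod 8 + y\<^sup>2 mod 8 + z\<^sup>2 mod 8) mod 8 \<noteq> 7"
    using sq[of x] sq[of y] sq[of z] by auto
  then have "(x\<^sup>2 + y\<^sup>2 + z\<^sup>2) mod 8 \<noteq> 7" unfolding mod_add3_eq .
  moreover have "(8 * b + 7) mod 8 = 7" by presburger
  ultimately show ?case by auto
next
  case (Suc a)
  show ?case
  proof
    assume eq: "x\<^sup>2 + y\<^sup>2 + z\<^sup>2 = 4 ^ Suc a * (8 * b + 7)"
    then have "4 dvd x\<^sup>2 + y\<^sup>2 + z\<^sup>2" by simp
    then obtain x' y' z' where "x = 2 * x'" "y = 2 * y'" "z = 2 * z'"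
      using even_if_sum_three_squares_mod_4 by (meson evenE)
    with eq have "x'\<^sup>2 + y'\<^sup>2 + z'\<^sup>2 = 4 ^ a * (8 * b + 7)"
      by (simp add: power_mult_distrib)
    with Suc.IH show False by blast
  qed
qed

section \<open>Differences within the codewords\<close>

text \<open>The support of a word, that is, the block that it indicates.\<close>

definition supp :: "nat list \<Rightarrow> nat set" where
  "supp x = {i. i < length x \<and> x ! i \<noteq> 0}"

text \<open>All choices of a codeword together with an ordered pair of distinct elements of its
  support.\<close>

definition pairs :: "nat list set \<Rightarrow> (nat list \<times> nat \<times> nat) set" where
  "pairs C = (SIGMA x:C. {(a, b). a \<in> supp x \<and> b \<in> supp x \<and> a \<noteq> b})"

text \<open>The difference of such a pair modulo \<open>v\<close>, as a residue in \<open>{0..<v}\<close>.  It is formed in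
  the integers to avoid truncated subtraction.\<close>

definition difference :: "nat \<Rightarrow> nat list \<times> nat \<times> nat \<Rightarrow> int" where
  "difference v = (\<lambda>(x, a, b). (int a - int b) mod int v)"

lemma finite_supp [simp]: "finite (supp x)"
  by (simp add: supp_def)

lemma card_supp: "card (supp x) = hamming_weight x"
  by (simp add: supp_def hamming_weight_def)

lemma off_diagonal_eq: "{(a, b). a \<in> S \<and> b \<in> S \<and> a \<noteq> b} = S \<times> S - (\<lambda>a. (a, a)) ` S"
  by auto

lemma sum_off_diagonal:
  fixes f :: "'a \<times> 'a \<Rightarrow> int"
  assumes "finite S"
  shows "sum f {(a, b). a \<in> S \<and> b \<in> S \<and> a \<noteq> b} = sum f (S \<times> S) - (\<Sum>a\<in>S. f (a, a))"
proof -
  have "sum f ((\<lambda>a. (a, a)) ` S) = (\<Sum>a\<in>S. f (a, a))"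
    by (subst sum.reindex) (auto simp: inj_on_def)
  moreover have "sum f (S \<times> S - (\<lambda>a. (a, a)) ` S) = sum f (S \<times> S) - sum f ((\<lambda>a. (a, a)) ` S)"
    using assms by (intro sum_diff) auto
  ultimately show ?thesis by (simp add: off_diagonal_eq)
qed

lemma finite_off_diagonal:
  "finite S \<Longrightarrow> finite {(a, b). a \<in> S \<and> b \<in> S \<and> a \<noteq> b}"
  by (simp add: off_diagonal_eq)

lemma sum_pairs:
  fixes f :: "nat list \<times> nat \<times> nat \<Rightarrow> int"
  assumes "finite C"
  shows "sum f (pairs C) =
    (\<Sum>x\<in>C. (\<Sum>a\<in>supp x. \<Sum>b\<in>supp x. f (x, a, b)) - (\<Sum>a\<in>supp x. f (x, a, a)))"
proof -
  have "sum f (pairs C) =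
      (\<Sum>x\<in>C. \<Sum>p\<in>{(a, b). a \<in> supp x \<and> b \<in> supp x \<and> a \<noteq> b}. f (x, p))"
    unfolding pairs_def using assms
    by (subst sum.Sigma) (auto intro: finite_off_diagonal)
  also have "\<dots> = (\<Sum>x\<in>C. (\<Sum>a\<in>supp x. \<Sum>b\<in>supp x. f (x, a, b)) - (\<Sum>a\<in>supp x. f (x, a, a)))"
    by (intro sum.cong refl, subst sum_off_diagonal) (auto simp: sum.cartesian_product)
  finally show ?thesis .
qed

lemma card_pairs:
  assumes "finite C" and "\<And>x. x \<in> C \<Longrightarrow> card (supp x) = k"
  shows "int (card (pairs C)) = int (card C) * int k * (int k - 1)"
proof -
  have "int (card (pairs C)) = sum (\<lambda>_. 1) (pairs C)" by simp
  also have "\<dots> = (\<Sum>x\<in>C. int (card (supp x)) * int (card (supp x)) - int (card (supp x)))"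
    by (subst sum_pairs) (use assms in auto)
  also have "\<dots> = int (card C) * (int k * int k - int k)"
    using assms by simp
  finally show ?thesis by (simp add: algebra_simps)
qed

text \<open>Two coincidences between the support of \<open>y\<close> and a translate of the support of \<open>x\<close>
  already push the correlation above the bound.\<close>

lemma correlation_ge_2:
  assumes "i < v" "j < v" "i \<noteq> j"
    and "x ! i \<noteq> 0" "x ! j \<noteq> 0" "y ! ((i + t) mod v) \<noteq> 0" "y ! ((j + t) mod v) \<noteq> (0::nat)"
  shows "(\<Sum>l<v. x ! l * y ! ((l + t) mod v)) \<ge> 2"
proof -
  let ?f = "\<lambda>l. x ! l * y ! ((l + t) mod v)"
  have "?f i > 0" "?f j > 0" using assms by auto
  then have "2 \<le> ?f i + ?f j" by linarith
  also have "\<dots> = sum ?f {i, j}" using assms(3) by simp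
  also have "\<dots> \<le> sum ?f {..<v}" using assms by (intro sum_mono2) auto
  finally show ?thesis .
qed

lemma inj_on_difference:
  assumes "is_OOC v k C"
  shows "inj_on (difference v) (pairs C)"
proof (rule inj_onI)
  fix p q
  assume p: "p \<in> pairs C" and q: "q \<in> pairs C" and eq: "difference v p = difference v q"
  obtain x a b where p_eq: "p = (x, a, b)" by (rule prod_cases3)
  obtain y c d where q_eq: "q = (y, c, d)" by (rule prod_cases3)
  from p have x: "x \<in> C" "a \<in> supp x" "b \<in> supp x" "a \<noteq> b" by (auto simp: pairs_def p_eq)
  from q have y: "y \<in> C" "c \<in> supp y" "d \<in> supp y" by (auto simp: pairs_def q_eq)
  have len: "length x = v" "length y = v" using assms x(1) y(1) by (auto simp: is_OOC_def)
  have nz: "a < v" "b < v" "c < v" "d < v" "x ! a \<noteq> 0" "x ! b \<noteq> 0" "y ! c \<noteq> 0" "y ! d \<noteq> 0"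
    using x y len by (auto simp: supp_def)
  \<comment> \<open>The translation by \<open>t\<close> takes \<open>a\<close> to \<open>c\<close>, and by equality of the differences also
    \<open>b\<close> to \<open>d\<close>.\<close>
  define t where "t = nat ((int c - int a) mod int v)"
  have t: "int t = (int c - int a) mod int v" "t < v"
    using nz(1) by (auto simp: t_def nat_less_iff)
  have "int ((a + t) mod v) = int c mod int v"
    unfolding zmod_int of_nat_add t(1) by (simp add: mod_simps)
  then have at: "(a + t) mod v = c" using nz by simp
  have "(int a - int b) mod int v = (int c - int d) mod int v"
    using eq by (simp add: difference_def p_eq q_eq)
  then have "(int c - (int a - int b)) mod int v = (int c - (int c - int d)) mod int v"
    by (rule mod_diff_cong[OF refl])
  then have "int ((b + t) mod v) = int d mod int v"
    unfolding zmod_int of_nat_add t(1) by (simp add: mod_simps algebra_simps)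
  then have bt: "(b + t) mod v = d" using nz by simp
  have ge: "(\<Sum>l<v. x ! l * y ! ((l + t) mod v)) \<ge> 2"
    using nz x(4) at bt by (intro correlation_ge_2[of a v b]) auto
  have "x = y \<and> t = 0"
  proof (rule ccontr)
    assume "\<not> (x = y \<and> t = 0)"
    then have "(\<Sum>l<v. x ! l * y ! ((l + t) mod v)) \<le> 1"
      using assms x(1) y(1) t(2) unfolding is_OOC_def by (metis neq0_conv)
    with ge show False by simp
  qed
  with at bt nz show "p = q" by (simp add: p_eq q_eq)
qed

text \<open>With \<open>n\<close> codewords there are \<open>n k (k - 1)\<close> differences, two fewer than the word
  length \<open>2h\<close>; the two missing residues are \<open>0\<close> and the involution \<open>h\<close>.\<close>

lemma image_difference:
  assumes ooc: "is_OOC (2 * h) k C" and "finite C"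
    and v: "2 * h = card C * k * (k - 1) + 2"
  shows "difference (2 * h) ` pairs C = {0..<2 * int h} - {0, int h}"
proof (rule card_subset_eq)
  have h: "h > 0" using v by simp
  note inj = inj_on_difference[OF ooc]
  have less: "a < 2 * h" if "x \<in> C" "a \<in> supp x" for x a
    using ooc that by (auto simp: is_OOC_def supp_def)
  show "difference (2 * h) ` pairs C \<subseteq> {0..<2 * int h} - {0, int h}"
  proof (clarify, intro DiffI)
    fix x a b
    assume p: "(x, a, b) \<in> pairs C"
    then have ab: "a < 2 * h" "b < 2 * h" "a \<noteq> b" and p': "(x, b, a) \<in> pairs C"
      using less by (auto simp: pairs_def)
    let ?d = "difference (2 * h) (x, a, b)"
    show "?d \<in> {0..<2 * int h}" using h by (simp add: difference_def)
    have "?d \<noteq> 0"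
    proof
      assume "?d = 0"
      then have "int a mod (2 * int h) = int b mod (2 * int h)"
        by (simp add: difference_def mod_eq_dvd_iff mod_eq_0_iff_dvd)
      with ab show False by simp
    qed
    moreover have "?d \<noteq> int h"
    proof
      assume eq: "?d = int h"
      \<comment> \<open>Then the reversed pair has the same difference \<open>- h = h\<close>.\<close>
      have "difference (2 * h) (x, b, a) = (- ((int a - int b) mod (2 * int h))) mod (2 * int h)"
        by (simp add: difference_def mod_simps)
      also have "\<dots> = (- int h) mod (2 * int h)" using eq by (simp add: difference_def)
      also have "\<dots> = int h mod (2 * int h)"
        by (simp only: mod_eq_dvd_iff) simp
      also have "\<dots> = int h" using h by simp
      finally have "?d = difference (2 * h) (x, b, a)" using eq by (simp only:)
      then have "(x, a, b) = (x, b, a)" using p p' by (rule inj_onD[OF inj])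
      with ab show False by simp
    qed
    ultimately show "?d \<notin> {0, int h}" by simp
  qed
  have "card (supp x) = k" if "x \<in> C" for x
    using ooc that by (simp add: card_supp is_OOC_def)
  then have "int (card (pairs C)) = int (card C) * int k * (int k - 1)"
    using \<open>finite C\<close> by (rule card_pairs[rotated])
  also have "\<dots> = 2 * int h - 2"
    using arg_cong[OF v, of int] by (cases k) (auto simp: algebra_simps)
  finally have "card (pairs C) = 2 * h - 2" by linarith
  moreover have "card ({0..<2 * int h} - {0, int h}) = 2 * h - 2"
    using h by (subst card_Diff_subset) auto
  ultimately show "card (difference (2 * h) ` pairs C) = card ({0..<2 * int h} - {0, int h})"
    using card_image[OF inj] by simp
qed simp

section \<open>The character sum\<close>

text \<open>The character of order two of \<open>\<int>\<close>, which factors through \<open>\<int>/v\<close> when \<open>v\<close> is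
  even.\<close>

definition sgn_char :: "int \<Rightarrow> int" where
  "sgn_char d = (if even d then 1 else - 1)"

lemma sgn_char_diff: "sgn_char (a - b) = sgn_char a * sgn_char b"
  by (simp add: sgn_char_def)

lemma sgn_char_difference:
  "sgn_char (difference (2 * h) (x, a, b)) = sgn_char (int a) * sgn_char (int b)"
proof -
  have "even (m mod (2 * int h)) = even m" for m :: int
    by (simp add: dvd_mod_iff)
  then have "sgn_char (m mod (2 * int h)) = sgn_char m" for m
    by (simp add: sgn_char_def)
  then show ?thesis by (simp add: difference_def sgn_char_diff)
qed

lemma sum_sgn_char: "(\<Sum>d\<in>{0..<2 * int h}. sgn_char d) = 0"
proof (induction h)
  case (Suc h)
  have "{0..<2 * int (Suc h)} = insert (2 * int h + 1) (insert (2 * int h) {0..<2 * int h})"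
    by auto
  then show ?case using Suc by (simp add: sgn_char_def)
qed simp

lemma sum_character_squares:
  assumes ooc: "is_OOC (2 * h) k C" and "finite C"
    and v: "2 * h = card C * k * (k - 1) + 2"
  shows "(\<Sum>x\<in>C. (\<Sum>a\<in>supp x. sgn_char (int a))\<^sup>2) = int (card C) * int k - 1 - sgn_char (int h)"
proof -
  let ?f = "\<lambda>p. sgn_char (difference (2 * h) p)"
  have h: "h > 0" using v by simp
  have "sum ?f (pairs C) = (\<Sum>d\<in>{0..<2 * int h} - {0, int h}. sgn_char d)"
    unfolding image_difference[OF assms, symmetric]
    by (subst sum.reindex[OF inj_on_difference[OF ooc]]) simp
  also have "\<dots> = - (\<Sum>d\<in>{0, int h}. sgn_char d)"
    using h by (subst sum_diff) (auto simp: sum_sgn_char)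
  also have "\<dots> = - 1 - sgn_char (int h)"
    using h by (simp add: sgn_char_def)
  finally have by_values: "sum ?f (pairs C) = - 1 - sgn_char (int h)" .
  have one: "sgn_char m * sgn_char m = 1" for m by (simp add: sgn_char_def)
  have "sum ?f (pairs C) =
      (\<Sum>x\<in>C. (\<Sum>a\<in>supp x. sgn_char (int a))\<^sup>2 - int (card (supp x)))"
    by (subst sum_pairs[OF \<open>finite C\<close>])
      (simp add: sgn_char_difference one sum_product power2_eq_square)
  also have "\<dots> = (\<Sum>x\<in>C. (\<Sum>a\<in>supp x. sgn_char (int a))\<^sup>2 - int k)"
    using ooc by (intro sum.cong) (auto simp: card_supp is_OOC_def)
  also have "\<dots> = (\<Sum>x\<in>C. (\<Sum>a\<in>supp x. sgn_char (int a))\<^sup>2) - int (card C) * int k"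
    by (simp add: sum_subtractf)
  finally show ?thesis using by_values by simp
qed

lemma three_squares_of_optimal_OOC:
  assumes "is_optimal_OOC (2 * h) k C" and v: "2 * h = 3 * k * (k - 1) + 2" and "k \<ge> 2"
  shows "\<exists>r s t :: int. r\<^sup>2 + s\<^sup>2 + t\<^sup>2 = 3 * int k - 1 - sgn_char (int h)"
proof -
  \<comment> \<open>For \<open>k \<ge> 2\<close> the term \<open>1\<close> in \<open>v - 1 = 3k(k - 1) + 1\<close> does not affect the quotient.\<close>
  have "k * (k - 1) \<ge> 2 * 1" using \<open>k \<ge> 2\<close> by (intro mult_le_mono) auto
  then have "(3 * (k * (k - 1)) + 1) div (k * (k - 1)) = 3"
    by (intro div_nat_eqI) (auto simp: algebra_simps)
  moreover have "2 * h - 1 = 3 * (k * (k - 1)) + 1" using v by (simp add: mult.assoc)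
  ultimately have card: "card C = 3"
    using assms(1) by (simp only: is_optimal_OOC_def)
  then obtain x y z where C: "C = {x, y, z}" "x \<noteq> y" "y \<noteq> z" "x \<noteq> z"
    by (auto simp: card_3_iff)
  define s where "s = (\<lambda>x. \<Sum>a\<in>supp x. sgn_char (int a))"
  have "(\<Sum>x\<in>C. (s x)\<^sup>2) = int (card C) * int k - 1 - sgn_char (int h)"
    unfolding s_def
    by (rule sum_character_squares) (use assms card C in \<open>auto simp: is_optimal_OOC_def\<close>)
  then have "(s x)\<^sup>2 + (s y)\<^sup>2 + (s z)\<^sup>2 = 3 * int k - 1 - sgn_char (int h)"
    using card C by (simp add: add.assoc)
  then show ?thesis by blast
qed

section \<open>Nonexistence\<close>

theorem theorem4p10:
  fixes k :: nat
  assumes "(\<exists>a c :: nat. real k = (4 ^ (a + 1) * (24 * real c + 7) + 2) / 3) \<or>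
           (\<exists>a c :: nat. k = 4 ^ (a + 1) * (8 * c + 5))"
  shows "\<not> (\<exists>C. is_optimal_OOC (3 * k * (k - 1) + 2) k C)"
proof
  assume "\<exists>C. is_optimal_OOC (3 * k * (k - 1) + 2) k C"
  then obtain C where C: "is_optimal_OOC (3 * k * (k - 1) + 2) k C" by blast
  from assms show False
  proof (elim disjE exE)
    fix a c :: nat
    assume "real k = (4 ^ (a + 1) * (24 * real c + 7) + 2) / 3"
    then have "real (3 * k) = real (4 ^ (a + 1) * (24 * c + 7) + 2)" by simp
    then have k: "3 * k = 4 ^ (a + 1) * (24 * c + 7) + 2" by (simp only: of_nat_eq_iff)
    define w where "w = 4 ^ a * (24 * c + 7)"
    have kw: "3 * k = 4 * w + 2" using k by (simp add: w_def)
    then have "\<exists>j. k = 4 * j + 2" by presburger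
    then obtain j where j: "k = 4 * j + 2" ..
    \<comment> \<open>Since \<open>k \<equiv> 2\<close> modulo \<open>4\<close>, the number \<open>k(k - 1)/2\<close> is odd.\<close>
    define h where "h = 3 * (2 * j + 1) * (4 * j + 1) + 1"
    have v: "2 * h = 3 * k * (k - 1) + 2" unfolding h_def j by (simp add: algebra_simps)
    have "even h" by (simp add: h_def)
    with three_squares_of_optimal_OOC[of h k C] C v j
    obtain r s t :: int where "r\<^sup>2 + s\<^sup>2 + t\<^sup>2 = 3 * int k - 2"
      by (auto simp: sgn_char_def)
    also have "\<dots> = 4 ^ (a + 1) * (8 * (3 * int c) + 7)"
      using arg_cong[OF k, of int] by simp
    finally show False using not_sum_three_squares by blast
  next
    fix a c :: nat
    assume k: "k = 4 ^ (a + 1) * (8 * c + 5)"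
    define j where "j = 4 ^ a * (8 * c + 5)"
    have j: "k = 4 * j" using k by (simp add: j_def)
    have "j > 0" by (simp add: j_def)
    \<comment> \<open>Since \<open>4\<close> divides \<open>k\<close>, the number \<open>k(k - 1)/2\<close> is even.\<close>
    define h where "h = 3 * (2 * j) * (4 * j - 1) + 1"
    have v: "2 * h = 3 * k * (k - 1) + 2" unfolding h_def j by simp
    have "odd h" by (simp add: h_def)
    with three_squares_of_optimal_OOC[of h k C] C v j \<open>j > 0\<close>
    obtain r s t :: int where "r\<^sup>2 + s\<^sup>2 + t\<^sup>2 = 3 * int k"
      by (auto simp: sgn_char_def)
    also have "\<dots> = 4 ^ (a + 1) * (8 * (3 * int c + 1) + 7)"
      using k by (simp add: algebra_simps)
    finally show False using not_sum_three_squares by blast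
  qed
qed

end
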